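(* Let $m,n$ be positive integers with $mn$ even, and let $y_1,\ldots,y_n$ be complex numbers with $y_1+\cdots+y_n=0$. Then for all $z\in\mathbb{C}$, \[ \sum_{k=0}^{mn-1}\prod_{j=1}^{n}\vartheta_4\!\left(z+y_j+\tfrac{k\pi}{mn}\Big|\tau\right)=R_4(m,n;\tau)\,\vartheta_3(mnz\,|\,m^2n\tau), \] where \[ R_4(m,n;\tau)=mn\sum_{\substack{r_1,\ldots,r_n\in\mathbb{Z}\\ r_1+\cdots+r_n=0}}q^{r_1^2+\cdots+r_n^2}e^{2i(r_1y_1+\cdots+r_ny_n)}. \]
   Context: Throughout, $\tau\in\mathbb{C}$ with $\Im(\tau)>0$ and $q=e^{\pi i\tau}$. The Jacobi theta functions are $\vartheta_3(z|\tau)=\sum_{n\in\mathbb{Z}}q^{n^2}e^{2niz}$ and $\vartheta_4(z|\tau)=\sum_{n\in\mathbb{Z}}(-1)^nq^{n^2}e^{2niz}$; $\vartheta_3(z|m^2n\tau)$ denotes $\vartheta_3$ with $\tau$ replaced by $m^2n\tau$. *)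

theory Defs
  imports "HOL-Analysis.Analysis"
begin

definition nome :: "complex \<Rightarrow> complex" where
  "nome \<tau> = exp (of_real pi * \<i> * \<tau>)"

definition jacobi_theta3 :: "complex \<Rightarrow> complex \<Rightarrow> complex" where
  "jacobi_theta3 z \<tau> =
     (\<Sum>\<^sub>\<infinity>n\<in>(UNIV :: int set). nome \<tau> powi (n\<^sup>2) * exp (2 * of_int n * \<i> * z))"

definition jacobi_theta4 :: "complex \<Rightarrow> complex \<Rightarrow> complex" where
  "jacobi_theta4 z \<tau> =
     (\<Sum>\<^sub>\<infinity>n\<in>(UNIV :: int set). (-1) powi n * nome \<tau> powi (n\<^sup>2) * exp (2 * of_int n * \<i> * z))"

text \<open>
  The integer tuples (r_1, ..., r_n) with sum 0; extensionality (\<open>\<rightarrow>\<^sub>E\<close>) makes each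
  tuple correspond to exactly one function, so that summing over this set counts every tuple once.
\<close>
definition zero_sum_tuples :: "nat \<Rightarrow> (nat \<Rightarrow> int) set" where
  "zero_sum_tuples n = {r \<in> {1..n} \<rightarrow>\<^sub>E UNIV. (\<Sum>j=1..n. r j) = 0}"

definition R4 :: "nat \<Rightarrow> nat \<Rightarrow> (nat \<Rightarrow> complex) \<Rightarrow> complex \<Rightarrow> complex" where
  "R4 m n y \<tau> =
     of_nat (m * n) *
     (\<Sum>\<^sub>\<infinity>r\<in>zero_sum_tuples n.
        nome \<tau> powi (\<Sum>j=1..n. (r j)\<^sup>2) * exp (2 * \<i> * (\<Sum>j=1..n. of_int (r j) * y j)))"

end

theory Submission
  imports Defs
begin

text \<open>
  Expanding the product of theta series gives a sum over integer vectors \<open>r\<close>. Averaging over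
  the shifts \<open>k\<pi>/(mn)\<close> is a roots-of-unity filter that keeps exactly those \<open>r\<close> whose coordinate
  sum is \<open>mns\<close> for some integer \<open>s\<close>. Subtracting \<open>ms\<close> from every coordinate yields a zero-sum
  vector \<open>r'\<close>; since \<open>\<Sum>r' = 0\<close> and \<open>\<Sum>y = 0\<close> all cross terms vanish, so the summand
  factors into a function of \<open>r'\<close> times a function of \<open>s\<close>.
\<close>

lemma has_sum_sum_finite:
  fixes f :: "'i \<Rightarrow> 'a \<Rightarrow> 'b :: topological_comm_monoid_add"
  assumes "finite I" "\<And>i. i \<in> I \<Longrightarrow> (f i has_sum s i) A"
  shows "((\<lambda>x. \<Sum>i\<in>I. f i x) has_sum (\<Sum>i\<in>I. s i)) A"
  using assms by (induction I rule: finite_induct) (auto intro!: has_sum_add)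

lemma infsum_sum_finite:
  fixes f :: "'i \<Rightarrow> 'a \<Rightarrow> 'b :: {topological_comm_monoid_add, t2_space}"
  assumes "finite I" "\<And>i. i \<in> I \<Longrightarrow> f i summable_on A"
  shows "infsum (\<lambda>x. \<Sum>i\<in>I. f i x) A = (\<Sum>i\<in>I. infsum (f i) A)"
  using assms by (intro infsumI has_sum_sum_finite) auto

text \<open>Serves to show that the multiplied-out product of theta series converges absolutely. The
  corresponding fact for measure-theoretic absolute summability is carried over to summability of
  norms; countability of the factors comes from there.\<close>

lemma abs_summable_on_prod_PiE_countable:
  fixes f :: "'i \<Rightarrow> 'a \<Rightarrow> 'b :: {real_normed_field, banach, second_countable_topology}"
  assumes "finite A" "\<And>x. x \<in> A \<Longrightarrow> countable (B x)"
    and "\<And>x. x \<in> A \<Longrightarrow> (\<lambda>t. norm (f x t)) summable_on B x"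
  shows "(\<lambda>g. norm (\<Prod>x\<in>A. f x (g x))) summable_on PiE A B"
  using abs_summable_on_prod_PiE[of A B f] assms by (simp add: abs_summable_equivalent)

lemma summable_on_int_exp_neg_abs: "(\<lambda>n::int. exp (- \<bar>real_of_int n\<bar>)) summable_on UNIV"
proof -
  have nat: "(\<lambda>n::nat. exp (- real n)) summable_on UNIV"
  proof -
    have "summable (\<lambda>n. exp (-1) ^ n :: real)"
      by (intro summable_geometric) simp
    then show ?thesis
      by (subst summable_on_UNIV_nonneg_real_iff) (simp_all flip: exp_of_nat_mult)
  qed
  have pos: "(\<lambda>n::int. exp (- \<bar>real_of_int n\<bar>)) summable_on range int"
    by (subst summable_on_reindex) (use nat in \<open>simp_all add: o_def\<close>)
  have neg: "(\<lambda>n::int. exp (- \<bar>real_of_int n\<bar>)) summable_on range (\<lambda>k. - int k)"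
    by (subst summable_on_reindex) (use nat in \<open>simp_all add: o_def inj_on_def\<close>)
  \<comment> \<open>The two ranges share \<open>0\<close>, which is harmless: summability passes to
    unions that need not be disjoint.\<close>
  have "(UNIV :: int set) = range int \<union> range (\<lambda>k. - int k)"
    by (auto intro: int_cases2)
  then show ?thesis
    using summable_on_union[OF pos neg] by simp
qed

text \<open>Completing the square bounds the exponent by a constant minus \<open>|n|\<close>, so a
  two-sided geometric series dominates.\<close>

lemma summable_on_int_exp_quadratic:
  fixes a b :: real
  assumes "a > 0"
  shows "(\<lambda>n::int. exp (b * real_of_int n - a * (real_of_int n)\<^sup>2)) summable_on UNIV"
proof (rule summable_on_comparison_test)
  \<comment> \<open>\<open>C\<close> is the maximum over real \<open>x\<close> of
    \<open>(|b| + 1) * x - a * x^2\<close>; the extra \<open>1\<close> leaves room for the decay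
    \<open>exp (- |n|)\<close>.\<close>
  define C where "C = (\<bar>b\<bar> + 1)\<^sup>2 / (4 * a)"
  show "(\<lambda>n::int. exp C * exp (- \<bar>real_of_int n\<bar>)) summable_on UNIV"
    by (intro summable_on_cmult_right summable_on_int_exp_neg_abs)
  fix n :: int
  define x where "x = \<bar>real_of_int n\<bar>"
  have "0 \<le> (2 * a * x - (\<bar>b\<bar> + 1))\<^sup>2 / (4 * a)"
    using assms by simp
  also have "\<dots> = a * x\<^sup>2 - (\<bar>b\<bar> + 1) * x + C"
    using assms by (simp add: C_def power2_eq_square field_simps)
  finally have "\<bar>b\<bar> * x - a * x\<^sup>2 \<le> C - x"
    by (simp add: algebra_simps)
  moreover have "b * real_of_int n \<le> \<bar>b\<bar> * x"
    unfolding x_def by (metis abs_ge_self abs_mult)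
  ultimately show "exp (b * real_of_int n - a * (real_of_int n)\<^sup>2) \<le> exp C * exp (- \<bar>real_of_int n\<bar>)"
    by (simp add: x_def flip: exp_add)
qed simp

lemma nome_powi: "nome \<tau> powi k = exp (of_int k * (of_real pi * \<i> * \<tau>))"
  by (simp add: nome_def exp_power_int)

text \<open>The sign has norm 1 and only \<open>Im w\<close> and \<open>Im \<tau>\<close> survive in
  the norm, so the terms have Gaussian size with quadratic coefficient
  \<open>pi * Im \<tau>\<close>.\<close>

lemma theta4_term_abs_summable:
  assumes "Im \<tau> > 0"
  shows "(\<lambda>r::int. norm ((-1) powi r * nome \<tau> powi (r\<^sup>2) * exp (2 * of_int r * \<i> * w))) summable_on UNIV"
proof -
  have "norm ((-1) powi r * nome \<tau> powi (r\<^sup>2) * exp (2 * of_int r * \<i> * w)) =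
      exp ((- 2 * Im w) * real_of_int r - (pi * Im \<tau>) * (real_of_int r)\<^sup>2)" for r :: int
    by (simp add: norm_mult norm_power_int nome_powi mult_ac flip: exp_add)
  then show ?thesis
    using summable_on_int_exp_quadratic[of "pi * Im \<tau>" "- 2 * Im w"] assms by simp
qed

text \<open>Separates \<open>u\<close> from the offsets \<open>y j\<close>: \<open>u\<close> enters
  only through the coordinate sum, so shifting it multiplies the term by a character of that
  sum.\<close>

lemma prod_theta4_terms:
  fixes r :: "'i \<Rightarrow> int" and y :: "'i \<Rightarrow> complex"
  assumes "finite I"
  shows "(\<Prod>j\<in>I. (-1) powi r j * nome \<tau> powi ((r j)\<^sup>2) * exp (2 * of_int (r j) * \<i> * (u + y j))) =
    (-1) powi (\<Sum>j\<in>I. r j) * (nome \<tau> powi (\<Sum>j\<in>I. (r j)\<^sup>2) *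
      exp (2 * \<i> * (\<Sum>j\<in>I. of_int (r j) * y j))) * exp (2 * \<i> * of_int (\<Sum>j\<in>I. r j) * u)"
  using assms
proof (induction I rule: finite_induct)
  case (insert j I)
  then show ?case
    by (simp add: power_int_add nome_powi algebra_simps exp_add)
qed simp

text \<open>This is a geometric sum whose ratio \<open>w\<close> satisfies \<open>w ^ N = 1\<close>,
  so it vanishes unless \<open>w = 1\<close>, which is the divisibility condition.\<close>

lemma sum_exp_roots_of_unity:
  fixes N :: nat and a :: int
  assumes "N > 0"
  shows "(\<Sum>k=0..N - 1. exp (2 * \<i> * of_int a * (of_nat k * of_real pi / of_nat N))) =
    (if int N dvd a then of_nat N else (0::complex))"
proof -
  define w :: complex where "w = exp (2 * \<i> * of_int a * (of_real pi / of_nat N))"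
  \<comment> \<open>Natural subtraction truncates, so this equality would fail for
    \<open>N = 0\<close>.\<close>
  have set: "{0..N - 1} = {..<N}"
    using assms by auto
  have pow: "exp (2 * \<i> * of_int a * (of_nat k * of_real pi / of_nat N)) = w ^ k" for k
    by (simp add: w_def mult_ac flip: exp_of_nat_mult)
  have "w ^ N = exp (\<i> * (of_int a * (of_real pi * 2)))"
    using assms by (simp add: w_def mult_ac flip: exp_of_nat_mult)
  then have wN: "w ^ N = 1"
    by simp
  have "w = 1 \<longleftrightarrow> int N dvd a"
  proof
    assume "w = 1"
    then obtain l :: int where "2 * real_of_int a * (pi / real N) = of_int (2 * l) * pi"
      unfolding w_def exp_eq_1 by (auto simp: complex_eq_iff)
    then have "real_of_int a = real_of_int (l * int N)"
      using assms by (simp add: field_simps)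
    then show "int N dvd a"
      by (metis dvd_triv_right of_int_eq_iff)
  next
    assume "int N dvd a"
    then obtain l where "a = int N * l" ..
    then have "w = exp (\<i> * (of_int l * (of_real pi * 2)))"
      using assms by (simp add: w_def mult_ac)
    then show "w = 1" by simp
  qed
  then show ?thesis
    unfolding set pow using wN by (simp add: sum_gp_strict)
qed

text \<open>A coordinate sum \<open>m * n * s\<close> is spread evenly, \<open>m * s\<close> on each
  of the \<open>n\<close> coordinates. This gives a bijection with pairs \<open>(r, s)\<close>, and
  Fubini splits the sum over pairs.\<close>

lemma infsum_dvd_sum_tuples:
  fixes f :: "(nat \<Rightarrow> int) \<Rightarrow> 'a :: banach"
  assumes "m > 0" "n > 0"
    and "f summable_on {r \<in> {1..n} \<rightarrow>\<^sub>E UNIV. int (m * n) dvd (\<Sum>j=1..n. r j)}"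
  shows "infsum f {r \<in> {1..n} \<rightarrow>\<^sub>E UNIV. int (m * n) dvd (\<Sum>j=1..n. r j)} =
    (\<Sum>\<^sub>\<infinity>r\<in>zero_sum_tuples n. \<Sum>\<^sub>\<infinity>s\<in>UNIV. f (\<lambda>j\<in>{1..n}. r j + int m * s))"
proof -
  let ?S = "{r \<in> {1..n} \<rightarrow>\<^sub>E UNIV. int (m * n) dvd (\<Sum>j=1..n. r j)}"
  let ?g = "\<lambda>(r, s). \<lambda>j\<in>{1..n}. r j + int m * s"
  \<comment> \<open>The inverse of \<open>?g\<close>: \<open>s\<close> is the quotient of the
    coordinate sum by \<open>m * n\<close>, and this division is exact on \<open>?S\<close>.\<close>
  let ?h = "\<lambda>r. (\<lambda>j\<in>{1..n}. r j - int m * ((\<Sum>j=1..n. r j) div int (m * n)),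
    (\<Sum>j=1..n. r j) div int (m * n))"
  have sum_shift: "(\<Sum>j=1..n. r j + int m * s) = (\<Sum>j=1..n. r j) + int (m * n) * s" for r s
    by (simp add: sum.distrib)
  have bij: "bij_betw ?g (zero_sum_tuples n \<times> UNIV) ?S"
  proof (rule bij_betw_byWitness[where f' = ?h])
    show "\<forall>p \<in> zero_sum_tuples n \<times> UNIV. ?h (?g p) = p"
      using assms(1,2)
      by (auto simp: zero_sum_tuples_def sum_shift PiE_def extensional_def fun_eq_iff
          simp del: of_nat_mult One_nat_def)
    show "\<forall>r \<in> ?S. ?g (?h r) = r"
      by (auto simp: PiE_def extensional_def fun_eq_iff)
    show "?g ` (zero_sum_tuples n \<times> UNIV) \<subseteq> ?S"
      by (auto simp: zero_sum_tuples_def sum_shift simp del: of_nat_mult One_nat_def)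
    show "?h ` ?S \<subseteq> zero_sum_tuples n \<times> UNIV"
      by (auto simp: zero_sum_tuples_def sum_subtractf elim!: dvdE)
  qed
  have "(\<lambda>p. f (?g p)) summable_on zero_sum_tuples n \<times> UNIV"
    using summable_on_reindex_bij_betw[OF bij] assms(3) by blast
  then have "(\<Sum>\<^sub>\<infinity>r\<in>zero_sum_tuples n. \<Sum>\<^sub>\<infinity>s\<in>UNIV. f (?g (r, s))) =
      infsum (\<lambda>p. f (?g p)) (zero_sum_tuples n \<times> UNIV)"
    by (rule infsum_Sigma_banach)
  also have "\<dots> = infsum f ?S"
    by (rule infsum_reindex_bij_betw[OF bij])
  finally show ?thesis by simp
qed

theorem theorem3p4:
  fixes m n :: nat and y :: "nat \<Rightarrow> complex" and \<tau> z :: complex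
  assumes "Im \<tau> > 0"
    and "m > 0" and "n > 0" and "even (m * n)"
    and "(\<Sum>j=1..n. y j) = 0"
  shows "(\<Sum>k=0..m * n - 1. \<Prod>j=1..n.
            jacobi_theta4 (z + y j + of_nat k * of_real pi / of_nat (m * n)) \<tau>)
         = R4 m n y \<tau> * jacobi_theta3 (of_nat (m * n) * z) (of_nat (m\<^sup>2 * n) * \<tau>)"
proof -
  define N where "N = m * n"
  have N: "N > 0" using assms by (simp add: N_def)
  define W :: "(nat \<Rightarrow> int) set" where "W = {1..n} \<rightarrow>\<^sub>E UNIV"
  define S where "S = {r \<in> W. int N dvd (\<Sum>j=1..n. r j)}"
  \<comment> \<open>\<open>G\<close> is the summand of \<open>R4\<close>; \<open>E u\<close> is the
    term of the expanded product at base point \<open>u\<close>, in the form that isolates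
    \<open>u\<close>.\<close>
  define G where "G r = nome \<tau> powi (\<Sum>j=1..n. (r j)\<^sup>2) *
    exp (2 * \<i> * (\<Sum>j=1..n. of_int (r j) * y j))" for r :: "nat \<Rightarrow> int"
  define E where "E u r = (-1) powi (\<Sum>j=1..n. r j) * G r *
    exp (2 * \<i> * of_int (\<Sum>j=1..n. r j) * u)" for u and r :: "nat \<Rightarrow> int"
  have E_prod: "E u = (\<lambda>r. \<Prod>j=1..n. (-1) powi r j * nome \<tau> powi ((r j)\<^sup>2) *
    exp (2 * of_int (r j) * \<i> * (u + y j)))" for u
    unfolding E_def G_def by (subst prod_theta4_terms) simp_all
  have E_summable: "E u summable_on W" for u
    unfolding E_prod W_def
    by (rule abs_summable_summable, rule abs_summable_on_prod_PiE_countable)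
      (simp_all only: theta4_term_abs_summable[OF assms(1)] finite_atLeastAtMost countableI_type)
  \<comment> \<open>The infinite distributive law, justified by absolute convergence of each
    factor.\<close>
  have prod_theta: "(\<Prod>j=1..n. jacobi_theta4 (u + y j) \<tau>) = infsum (E u) W" for u
    unfolding E_prod W_def jacobi_theta4_def
    by (rule infsum_prod_PiE_abs[symmetric])
      (simp_all only: theta4_term_abs_summable[OF assms(1)] finite_atLeastAtMost)
  have shift: "E (z + c) r = E z r * exp (2 * \<i> * of_int (\<Sum>j=1..n. r j) * c)" for c r
    by (simp add: E_def ring_distribs exp_add mult_ac)
  have filter: "(\<Sum>k=0..N - 1. E (z + of_nat k * of_real pi / of_nat N) r) =
      (if int N dvd (\<Sum>j=1..n. r j) then of_nat N * E z r else 0)" for r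
    unfolding shift sum_distrib_left[symmetric] sum_exp_roots_of_unity[OF N] by simp
  have factor: "E z (\<lambda>j\<in>{1..n}. r j + int m * s) = G r *
      (nome (of_nat (m\<^sup>2 * n) * \<tau>) powi s\<^sup>2 * exp (2 * of_int s * \<i> * (of_nat (m * n) * z)))"
    if "r \<in> zero_sum_tuples n" for r s
  proof -
    let ?r = "\<lambda>j\<in>{1..n}. r j + int m * s"
    have r0: "(\<Sum>j=1..n. r j) = 0"
      using that by (simp add: zero_sum_tuples_def)
    have sum1: "(\<Sum>j=1..n. ?r j) = int (m * n) * s"
      by (simp add: sum.distrib r0 del: One_nat_def)
    have "(\<Sum>j=1..n. (?r j)\<^sup>2) =
        (\<Sum>j=1..n. (r j)\<^sup>2 + 2 * int m * s * r j + int (m\<^sup>2) * s\<^sup>2)"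
      by (intro sum.cong) (auto simp: power2_eq_square algebra_simps)
    \<comment> \<open>The cross terms add up to \<open>2 * m * s\<close> times the coordinate sum of
      \<open>r\<close>, which is 0.\<close>
    also have "\<dots> = (\<Sum>j=1..n. (r j)\<^sup>2) + int (m\<^sup>2 * n) * s\<^sup>2"
      by (simp add: sum.distrib r0 del: One_nat_def flip: sum_distrib_left)
    finally have sum2: "(\<Sum>j=1..n. (?r j)\<^sup>2) = (\<Sum>j=1..n. (r j)\<^sup>2) + int (m\<^sup>2 * n) * s\<^sup>2" .
    have "(\<Sum>j=1..n. of_int (?r j) * y j) =
        (\<Sum>j=1..n. of_int (r j) * y j + of_int (int m * s) * y j)"
      by (intro sum.cong) (auto simp: algebra_simps)
    \<comment> \<open>The zero sum of the \<open>y j\<close> removes \<open>s\<close> from this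
      exponent.\<close>
    also have "\<dots> = (\<Sum>j=1..n. of_int (r j) * y j)"
      by (simp add: sum.distrib assms(5) del: One_nat_def flip: sum_distrib_left)
    finally have sum3: "(\<Sum>j=1..n. of_int (?r j) * y j) = (\<Sum>j=1..n. of_int (r j) * y j)" .
    \<comment> \<open>Evenness of \<open>m * n\<close> makes the alternating sign disappear, which
      is why \<open>jacobi_theta3\<close> rather than \<open>jacobi_theta4\<close> results.\<close>
    have sign: "(-1 :: complex) powi (int (m * n) * s) = 1"
      using assms(4) by (simp add: power_int_mult del: of_nat_mult even_mult_iff)
    \<comment> \<open>The factor \<open>m^2 * n\<close> in the exponent moves into the argument of
      \<open>nome\<close>; this is the source of the rescaled modulus.\<close>
    have nome: "nome \<tau> powi (int (m\<^sup>2 * n) * s\<^sup>2) = nome (of_nat (m\<^sup>2 * n) * \<tau>) powi s\<^sup>2"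
      by (simp add: nome_powi mult_ac)
    have "nome \<tau> \<noteq> 0" by (simp add: nome_def)
    then have "G ?r = G r * nome (of_nat (m\<^sup>2 * n) * \<tau>) powi s\<^sup>2"
      unfolding G_def sum2 sum3 using nome by (simp add: power_int_add)
    then show ?thesis
      unfolding E_def sum1 sign by (simp add: mult_ac)
  qed
  have S_W: "S \<subseteq> W" by (auto simp: S_def)
  have "(\<Sum>k=0..N - 1. \<Prod>j=1..n. jacobi_theta4 (z + y j + of_nat k * of_real pi / of_nat N) \<tau>) =
      (\<Sum>k=0..N - 1. infsum (E (z + of_nat k * of_real pi / of_nat N)) W)"
    unfolding prod_theta[symmetric] by (simp add: add_ac)
  also have "\<dots> = infsum (\<lambda>r. \<Sum>k=0..N - 1. E (z + of_nat k * of_real pi / of_nat N) r) W"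
    by (rule infsum_sum_finite[symmetric]) (simp_all add: E_summable)
  \<comment> \<open>Tuples outside \<open>S\<close> contribute 0 after the filter, so the index set
    shrinks from \<open>W\<close> to \<open>S\<close>.\<close>
  also have "\<dots> = infsum (\<lambda>r. of_nat N * E z r) S"
    unfolding filter by (rule infsum_cong_neutral) (auto simp: S_def)
  also have "\<dots> = of_nat N * infsum (E z) S"
    by (rule infsum_cmult_right')
  also have "infsum (E z) S = (\<Sum>\<^sub>\<infinity>r\<in>zero_sum_tuples n. \<Sum>\<^sub>\<infinity>s\<in>UNIV. E z (\<lambda>j\<in>{1..n}. r j + int m * s))"
    using infsum_dvd_sum_tuples[OF assms(2,3), of "E z"] summable_on_subset_banach[OF E_summable S_W]
    unfolding S_def W_def N_def by simp
  \<comment> \<open>By \<open>factor\<close>, \<open>G r\<close> leaves the inner sum; what remains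
    there is the theta series, constant in \<open>r\<close>, which leaves the outer sum.\<close>
  also have "\<dots> = (\<Sum>\<^sub>\<infinity>r\<in>zero_sum_tuples n. G r) *
      jacobi_theta3 (of_nat (m * n) * z) (of_nat (m\<^sup>2 * n) * \<tau>)"
    by (simp add: factor infsum_cmult_right' infsum_cmult_left' jacobi_theta3_def
        del: One_nat_def cong: infsum_cong)
  finally show ?thesis
    unfolding R4_def G_def N_def by (simp add: mult.assoc)
qed

end
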